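(* There is a constant $C>0$ such that for every $d$ and every $k\in[d]$ there exists a real polynomial $p$ in $d$ variables such that (i) $|p(x)-\mathrm{OR}_d(x)|\le 1/400$ for every $x\in\{-1,1\}^d$ with $|x|\le k$; (ii) the $L_1$-weight of the coefficient vector of $p$ is at most $d^{0.01}$; and (iii) the degree of $p$ is at most $\min\left\{d^{1-\frac{1}{C\sqrt{k}}},\ \frac{d}{\log^{0.995} d}\right\}$.
   Context: $\mathrm{OR}_d:\{-1,1\}^d\to\{-1,1\}$ is the OR function on $d$ variables with the convention that $-1$ means TRUE and $1$ means FALSE (so $\mathrm{OR}_d(x)=1$ iff $x=(1,\dots,1)$). For $x\in\{-1,1\}^d$, $|x|$ denotes the number of coordinates of $x$ equal to $-1$. A real polynomial is written in multilinear form $p(x)=\sum_{S\subseteq[d]}c_S\prod_{i\in S}x_i$; its $L_1$-weight is $\sum_S|c_S|$ and its degree is $\max\{|S|:c_S\neq0\}$.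
   Formalization: "For every d" is replaced by "for every d at least some absolute constant d_0": the literal claim fails for small d (for d=2, k=1, condition (iii) forces p affine, so (i) forces weight at least 1.995 > 2^0.01); log is taken to base 2. *)

theory Defs
  imports Complex_Main "HOL-Library.FuncSet"
begin

text \<open>Truth values are encoded with \<open>-1\<close> for TRUE and \<open>1\<close> for FALSE.\<close>

definition cube :: "nat \<Rightarrow> (nat \<Rightarrow> real) set" where
  "cube d = {1..d} \<rightarrow>\<^sub>E {-1, 1}"

definition OR_fun :: "nat \<Rightarrow> (nat \<Rightarrow> real) \<Rightarrow> real" where
  "OR_fun d x = (if \<exists>i\<in>{1..d}. x i = -1 then -1 else 1)"

definition num_true :: "nat \<Rightarrow> (nat \<Rightarrow> real) \<Rightarrow> nat" where
  "num_true d x = card {i \<in> {1..d}. x i = -1}"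

text \<open>A real multilinear polynomial in \<open>d\<close> variables is given by its coefficients
  \<open>c S\<close>, of which only those with \<open>S \<subseteq> {1..d}\<close> are relevant.\<close>

definition ml_eval :: "nat \<Rightarrow> (nat set \<Rightarrow> real) \<Rightarrow> (nat \<Rightarrow> real) \<Rightarrow> real" where
  "ml_eval d c x = (\<Sum>S\<in>Pow {1..d}. c S * (\<Prod>i\<in>S. x i))"

definition ml_weight :: "nat \<Rightarrow> (nat set \<Rightarrow> real) \<Rightarrow> real" where
  "ml_weight d c = (\<Sum>S\<in>Pow {1..d}. \<bar>c S\<bar>)"

text \<open>Inserting \<open>0\<close> fixes the degree of the zero polynomial to be \<open>0\<close>.\<close>

definition ml_degree :: "nat \<Rightarrow> (nat set \<Rightarrow> real) \<Rightarrow> nat" where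
  "ml_degree d c = Max (insert 0 (card ` {S \<in> Pow {1..d}. c S \<noteq> 0}))"

end

theory Submission
  imports Defs "HOL-Real_Asymp.Real_Asymp"
begin

text \<open>
  Split the variables into \<open>m\<close> blocks. The indicator that a block is all-false has weight 1
  and degree about \<open>d / m\<close>, so the number \<open>t\<close> of blocks containing a true variable is a cheap
  polynomial, and \<open>t \<le> K\<close> for both \<open>K = m\<close> and \<open>K = k\<close>. The affine map sending \<open>t = 0\<close> to \<open>1 + 1/K\<close> and
  \<open>[1, K]\<close> into \<open>[-1, 1]\<close>, followed by the Chebyshev polynomial of degree \<open>r = O(\<surd>K)\<close>, separates
  \<open>t = 0\<close> from \<open>t \<ge> 1\<close>, at degree \<open>O(\<surd>K d / m)\<close> and weight \<open>O(m / K)\<close> to the power \<open>r\<close>.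
  Take \<open>K = k\<close> and \<open>m\<close> equal to \<open>d\<close> to the power \<open>1 / (10000 \<surd>k)\<close> when \<open>\<surd>k log log d \<le> log d / 40000\<close>. For
  larger \<open>k\<close> take \<open>m\<close> of order \<open>(log d)\<^sup>2\<close> with \<open>K = m\<close>, which handles all inputs at degree
  \<open>O(d / log d)\<close>; there the second term of the minimum is the smaller one.
\<close>

section \<open>Calculus of weight and degree for functions on the cube\<close>

text \<open>Agreement is required on the cube only, so that products may be reduced to multilinear
  form by \<open>x i * x i = 1\<close>. \<open>W\<close> and \<open>D\<close> are upper bounds,
  which lets them be propagated through sums and products without exact coefficients.\<close>

definition ml_representable :: "nat \<Rightarrow> ((nat \<Rightarrow> real) \<Rightarrow> real) \<Rightarrow> real \<Rightarrow> nat \<Rightarrow> bool" where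
  "ml_representable d f W D \<longleftrightarrow>
     (\<exists>c. (\<forall>x\<in>cube d. ml_eval d c x = f x) \<and> ml_weight d c \<le> W \<and> ml_degree d c \<le> D)"

lemma ml_degree_le_iff:
  "ml_degree d c \<le> D \<longleftrightarrow> (\<forall>S. S \<subseteq> {1..d} \<longrightarrow> c S \<noteq> 0 \<longrightarrow> card S \<le> D)"
  unfolding ml_degree_def by (subst Max_le_iff) auto

lemma ml_representable_cong:
  assumes "ml_representable d f W D" and "\<And>x. x \<in> cube d \<Longrightarrow> f x = g x"
    and "W \<le> W'" and "D \<le> D'"
  shows "ml_representable d g W' D'"
  using assms unfolding ml_representable_def by (metis order_trans)

lemma ml_representable_monomial:
  assumes "S \<subseteq> {1..d}"
  shows "ml_representable d (\<lambda>x. a * (\<Prod>i\<in>S. x i)) \<bar>a\<bar> (card S)"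
proof -
  let ?c = "\<lambda>T. if T = S then a else 0"
  have "ml_eval d ?c x = a * (\<Prod>i\<in>S. x i)" for x
    unfolding ml_eval_def using assms by (subst sum.remove[of _ S]) auto
  moreover have "ml_weight d ?c = \<bar>a\<bar>"
    unfolding ml_weight_def using assms by (subst sum.remove[of _ S]) auto
  moreover have "ml_degree d ?c \<le> card S"
    by (auto simp: ml_degree_le_iff)
  ultimately show ?thesis
    unfolding ml_representable_def by (intro exI[of _ ?c]) auto
qed

lemma ml_representable_const: "ml_representable d (\<lambda>x. a) \<bar>a\<bar> 0"
  using ml_representable_monomial[of "{}" d a] by simp

lemma ml_representable_var:
  assumes "i \<in> {1..d}"
  shows "ml_representable d (\<lambda>x. x i) 1 1"
  using ml_representable_monomial[of "{i}" d 1] assms by simp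

lemma ml_representable_add:
  assumes "ml_representable d f W D" "ml_representable d g V E"
  shows "ml_representable d (\<lambda>x. f x + g x) (W + V) (max D E)"
proof -
  obtain c e where c: "\<forall>x\<in>cube d. ml_eval d c x = f x" "ml_weight d c \<le> W" "ml_degree d c \<le> D"
    and e: "\<forall>x\<in>cube d. ml_eval d e x = g x" "ml_weight d e \<le> V" "ml_degree d e \<le> E"
    using assms unfolding ml_representable_def by blast
  let ?s = "\<lambda>S. c S + e S"
  have "ml_eval d ?s x = ml_eval d c x + ml_eval d e x" for x
    by (simp add: ml_eval_def algebra_simps sum.distrib)
  moreover have "ml_weight d ?s \<le> ml_weight d c + ml_weight d e"
    by (simp add: ml_weight_def flip: sum.distrib) (intro sum_mono abs_triangle_ineq)
  moreover have "ml_degree d ?s \<le> max D E"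
    using c(3) e(3) unfolding ml_degree_le_iff
    by (metis add.right_neutral le_max_iff_disj)
  ultimately show ?thesis
    unfolding ml_representable_def using c e by (intro exI[of _ ?s]) auto
qed

lemma ml_representable_sum:
  fixes W :: real
  assumes "\<And>j. j \<in> J \<Longrightarrow> ml_representable d (f j) W D"
  shows "ml_representable d (\<lambda>x. \<Sum>j\<in>J. f j x) (card J * W) D"
  using assms
proof (induction J rule: infinite_finite_induct)
  \<comment> \<open>For an infinite index set the sum and its cardinality both default to 0.\<close>
  case (infinite A)
  then show ?case using ml_representable_cong[OF ml_representable_const[of d 0]] by simp
next
  case empty
  then show ?case using ml_representable_cong[OF ml_representable_const[of d 0]] by simp
next
  case (insert j J)
  have "ml_representable d (\<lambda>x. f j x + (\<Sum>j\<in>J. f j x)) (W + card J * W) (max D D)"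
    using insert by (intro ml_representable_add) auto
  then show ?case using insert by (simp add: algebra_simps)
qed

lemma symm_diff_bij_betw:
  assumes "T \<subseteq> A"
  shows "bij_betw (\<lambda>S. sym_diff S T) (Pow A) (Pow A)"
  by (rule bij_betw_byWitness[where f' = "\<lambda>S. sym_diff S T"]) (use assms in auto)

text \<open>Indices in \<open>S \<inter> T\<close> occur squared in the product of the two
  monomials, and squares of coordinates are 1 on the cube.\<close>

lemma prod_symm_diff_cube:
  assumes "x \<in> cube d" "S \<subseteq> {1..d}" "T \<subseteq> {1..d}"
  shows "(\<Prod>i\<in>sym_diff S T. x i) = (\<Prod>i\<in>S. x i) * (\<Prod>i\<in>T. x i)"
proof -
  have fin: "finite S" "finite T"
    using assms finite_subset by auto
  have sq: "x i * x i = 1" if "i \<in> {1..d}" for i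
    using PiE_mem[OF assms(1)[unfolded cube_def] that] by auto
  have "(\<Prod>i\<in>S. x i) * (\<Prod>i\<in>T. x i)
      = (\<Prod>i\<in>S - T. x i) * (\<Prod>i\<in>T - S. x i) * (\<Prod>i\<in>S \<inter> T. x i * x i)"
    using prod.Int_Diff[of S x T] prod.Int_Diff[of T x S] fin
    by (simp add: prod.distrib Int_commute mult_ac)
  also have "(\<Prod>i\<in>S \<inter> T. x i * x i) = 1"
    using sq assms(2) by (intro prod.neutral) blast
  also have "(\<Prod>i\<in>S - T. x i) * (\<Prod>i\<in>T - S. x i) = (\<Prod>i\<in>sym_diff S T. x i)"
    by (subst prod.union_disjoint) (use fin in auto)
  finally show ?thesis by simp
qed

text \<open>Since monomials multiply by symmetric difference, the coefficients of the product are a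
  convolution. The L1 norm is submultiplicative under convolution, and \<open>S\<close> is covered
  by \<open>T\<close> and \<open>sym_diff S T\<close>, so degrees add at most.\<close>

lemma ml_representable_mult:
  assumes "ml_representable d f W D" "ml_representable d g V E"
  shows "ml_representable d (\<lambda>x. f x * g x) (W * V) (D + E)"
proof -
  obtain c e where c: "\<forall>x\<in>cube d. ml_eval d c x = f x" "ml_weight d c \<le> W" "ml_degree d c \<le> D"
    and e: "\<forall>x\<in>cube d. ml_eval d e x = g x" "ml_weight d e \<le> V" "ml_degree d e \<le> E"
    using assms unfolding ml_representable_def by blast
  let ?P = "Pow {1..d}"
  let ?s = "\<lambda>S. \<Sum>T\<in>?P. c T * e (sym_diff S T)"
  have invol: "sym_diff (sym_diff S T) T = S" for S T :: "nat set"
    by auto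
  \<comment> \<open>Translation by \<open>T\<close> is an involution on the subsets; this reindexing
    serves both the evaluation and the weight bound.\<close>
  have shift: "(\<Sum>S\<in>?P. h (sym_diff S T)) = (\<Sum>S\<in>?P. h S)"
    if "T \<in> ?P" for h :: "nat set \<Rightarrow> real" and T
    using sum.reindex_bij_betw[OF symm_diff_bij_betw, of T "{1..d}" h] that by simp
  have "ml_eval d ?s x = ml_eval d c x * ml_eval d e x" if x: "x \<in> cube d" for x
  proof -
    have "ml_eval d ?s x = (\<Sum>T\<in>?P. \<Sum>S\<in>?P. c T * e (sym_diff S T) * (\<Prod>i\<in>S. x i))"
      unfolding ml_eval_def sum_distrib_right by (rule sum.swap)
    also have "\<dots> = (\<Sum>T\<in>?P. \<Sum>S\<in>?P. c T * e S * (\<Prod>i\<in>sym_diff S T. x i))"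
    proof (rule sum.cong[OF refl])
      fix T assume "T \<in> ?P"
      from shift[OF this, of "\<lambda>S. c T * e S * (\<Prod>i\<in>sym_diff S T. x i)"]
      show "(\<Sum>S\<in>?P. c T * e (sym_diff S T) * (\<Prod>i\<in>S. x i))
          = (\<Sum>S\<in>?P. c T * e S * (\<Prod>i\<in>sym_diff S T. x i))"
        unfolding invol .
    qed
    also have "\<dots> = (\<Sum>T\<in>?P. \<Sum>S\<in>?P. (c T * (\<Prod>i\<in>T. x i)) * (e S * (\<Prod>i\<in>S. x i)))"
      by (intro sum.cong refl) (simp add: prod_symm_diff_cube[OF x] mult_ac)
    finally show ?thesis
      by (simp add: ml_eval_def sum_product)
  qed
  moreover have "ml_weight d ?s \<le> W * V"
  proof -
    have "ml_weight d ?s \<le> (\<Sum>S\<in>?P. \<Sum>T\<in>?P. \<bar>c T\<bar> * \<bar>e (sym_diff S T)\<bar>)"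
      unfolding ml_weight_def
      by (intro sum_mono order_trans[OF sum_abs]) (simp add: abs_mult)
    also have "\<dots> = (\<Sum>T\<in>?P. \<Sum>S\<in>?P. \<bar>c T\<bar> * \<bar>e (sym_diff S T)\<bar>)"
      by (rule sum.swap)
    also have "\<dots> = (\<Sum>T\<in>?P. \<Sum>S\<in>?P. \<bar>c T\<bar> * \<bar>e S\<bar>)"
      by (rule sum.cong[OF refl], rule shift)
    also have "\<dots> = ml_weight d c * ml_weight d e"
      by (simp add: ml_weight_def sum_product)
    also have "\<dots> \<le> W * V"
      using c(2) e(2) by (intro mult_mono') (auto simp: ml_weight_def intro!: sum_nonneg)
    finally show ?thesis .
  qed
  moreover have "ml_degree d ?s \<le> D + E"
    unfolding ml_degree_le_iff
  proof (intro allI impI)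
    fix S assume S: "S \<subseteq> {1..d}" "?s S \<noteq> 0"
    then obtain T where T: "T \<subseteq> {1..d}" "c T * e (sym_diff S T) \<noteq> 0"
      by (metis (no_types, lifting) PowD sum.neutral)
    have "card S \<le> card (T \<union> sym_diff S T)"
      using S(1) T(1) by (intro card_mono) (auto intro: finite_subset)
    also have "\<dots> \<le> card T + card (sym_diff S T)"
      by (rule card_Un_le)
    also have "\<dots> \<le> D + E"
    proof (rule add_mono)
      show "card T \<le> D"
        using c(3) T unfolding ml_degree_le_iff by auto
      have "sym_diff S T \<subseteq> {1..d}" using S(1) T(1) by auto
      then show "card (sym_diff S T) \<le> E"
        using e(3) T unfolding ml_degree_le_iff by auto
    qed
    finally show "card S \<le> D + E" .
  qed
  ultimately show ?thesis
    unfolding ml_representable_def using c e by (intro exI[of _ ?s]) auto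
qed

lemma ml_representable_cmult:
  assumes "ml_representable d f W D"
  shows "ml_representable d (\<lambda>x. a * f x) (\<bar>a\<bar> * W) D"
  using ml_representable_mult[OF ml_representable_const assms, of a] by simp

text \<open>Each factor has weight 1/2 + 1/2 = 1, so the weight stays 1 however large the block is.
  On the cube the product indicates that the block has no true variable.\<close>

lemma ml_representable_none_true:
  assumes "B \<subseteq> {1..d}"
  shows "ml_representable d (\<lambda>x. \<Prod>i\<in>B. (1 + x i) / 2) 1 (card B)"
proof -
  have "finite B" using assms finite_subset by auto
  then show ?thesis using assms
  proof (induction B)
    case empty
    then show ?case using ml_representable_const[of d 1] by simp
  next
    case (insert i B)
    have "ml_representable d (\<lambda>x. (1/2) * (1 + x i)) (\<bar>1/2\<bar> * (\<bar>1\<bar> + 1)) (max 0 1)"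
      using insert.prems
      by (intro ml_representable_cmult ml_representable_add ml_representable_const
          ml_representable_var) auto
    then have "ml_representable d (\<lambda>x. (1/2) * (1 + x i) * (\<Prod>i\<in>B. (1 + x i) / 2))
        (\<bar>1/2\<bar> * (\<bar>1\<bar> + 1) * 1) (max 0 1 + card B)"
      using insert by (intro ml_representable_mult) auto
    then show ?case using insert by simp
  qed
qed

section \<open>Chebyshev polynomials\<close>

text \<open>The Chebyshev polynomials of the first kind, by their three-term recurrence, which also
  drives the weight bound.\<close>

fun cheb :: "nat \<Rightarrow> real \<Rightarrow> real" where
  "cheb 0 y = 1"
| "cheb (Suc 0) y = y"
| "cheb (Suc (Suc n)) y = 2 * y * cheb (Suc n) y - cheb n y"

lemma cheb_cos: "cheb n (cos t) = cos (n * t)"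
proof (induction n rule: induct_nat_012)
  case (ge2 n)
  have "cos (real (Suc (Suc n)) * t) + cos (real n * t) = 2 * cos t * cos (real (Suc n) * t)"
    using cos_plus_cos[of "real (Suc (Suc n)) * t" "real n * t"]
    by (simp add: algebra_simps add_divide_distrib)
  then show ?case using ge2 by simp
qed auto

lemma abs_cheb_le_1:
  assumes "\<bar>y\<bar> \<le> 1"
  shows "\<bar>cheb n y\<bar> \<le> 1"
  using cheb_cos[of n "arccos y"] assms by (simp add: cos_arccos abs_le_iff)

text \<open>At \<open>1 + \<mu>\<close> the recurrence says that each consecutive difference exceeds
  the previous one by \<open>2 * \<mu>\<close> times a value that is at least 1. The differences are
  thus at least \<open>(2 * n + 1) * \<mu>\<close>, and the odd numbers sum to a square. The
  induction carries the bounds on value and difference together.\<close>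

lemma cheb_growth:
  assumes "\<mu> \<ge> 0"
  shows "cheb n (1 + \<mu>) \<ge> 1 + (real n)\<^sup>2 * \<mu>"
proof -
  have "cheb n (1 + \<mu>) \<ge> 1 + (real n)\<^sup>2 * \<mu> \<and>
        cheb (Suc n) (1 + \<mu>) - cheb n (1 + \<mu>) \<ge> (2 * real n + 1) * \<mu>"
  proof (induction n)
    case (Suc n)
    let ?a = "\<lambda>n. cheb n (1 + \<mu>)"
    have 1: "?a (Suc n) \<ge> 1 + (real (Suc n))\<^sup>2 * \<mu>"
      using Suc by (simp add: power2_eq_square algebra_simps)
    have "?a (Suc n) \<ge> 1"
      using 1 assms by (meson le_add_same_cancel1 mult_nonneg_nonneg order_trans zero_le_power2)
    then have "2 * \<mu> * ?a (Suc n) \<ge> 2 * \<mu>"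
      using assms mult_left_mono[of 1 "?a (Suc n)" "2 * \<mu>"] by simp
    moreover have "?a (Suc (Suc n)) - ?a (Suc n) = ?a (Suc n) - ?a n + 2 * \<mu> * ?a (Suc n)"
      by (simp add: algebra_simps)
    ultimately have "?a (Suc (Suc n)) - ?a (Suc n) \<ge> (2 * real (Suc n) + 1) * \<mu>"
      using Suc by (simp add: algebra_simps)
    with 1 show ?case by blast
  qed (use assms in auto)
  then show ?thesis by blast
qed

text \<open>One step of the recurrence multiplies the weight by at most \<open>2 * W\<close> and
  adds the weight from two steps before, which is absorbed by the summand 1 in the base
  \<open>2 * W + 1\<close>.\<close>

lemma ml_representable_cheb:
  assumes "ml_representable d f W D" "W \<ge> 0"
  shows "ml_representable d (\<lambda>x. cheb n (f x)) ((2 * W + 1) ^ n) (n * D)"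
proof (induction n rule: induct_nat_012)
  case 0
  then show ?case using ml_representable_const[of d 1] by simp
next
  case 1
  show ?case using assms by (auto intro: ml_representable_cong)
next
  case (ge2 n)
  let ?B = "2 * W + 1"
  have "ml_representable d (\<lambda>x. 2 * (f x * cheb (Suc n) (f x)) + (- 1) * cheb n (f x))
      (\<bar>2\<bar> * (W * ?B ^ Suc n) + \<bar>- 1\<bar> * ?B ^ n) (max (D + Suc n * D) (n * D))"
    by (intro ml_representable_add ml_representable_cmult ml_representable_mult assms ge2)
  moreover have "\<bar>2\<bar> * (W * ?B ^ Suc n) + \<bar>- 1\<bar> * ?B ^ n \<le> ?B ^ Suc (Suc n)"
  proof -
    have "?B ^ n \<le> ?B ^ Suc n" using assms(2) by (intro power_increasing) auto
    then show ?thesis by (simp add: algebra_simps)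
  qed
  ultimately show ?case
    by (rule_tac ml_representable_cong) (auto simp: algebra_simps)
qed

section \<open>Approximating OR through blocks of variables\<close>

text \<open>The blocks will be the residue classes modulo \<open>m\<close>; inside one class,
  \<open>i\<close> is determined by \<open>i div m\<close>.\<close>

lemma card_residue_class_le:
  assumes "m \<ge> 1"
  shows "card {i \<in> {1..d}. i mod m = j} \<le> d div m + 1"
proof -
  have "inj_on (\<lambda>i. i div m) {i \<in> {1..d}. i mod m = j}"
    by (rule inj_onI) (metis (mono_tags, lifting) div_mult_mod_eq mem_Collect_eq)
  moreover have "(\<lambda>i. i div m) ` {i \<in> {1..d}. i mod m = j} \<subseteq> {0..d div m}"
    by (auto intro: div_le_mono)
  ultimately have "card {i \<in> {1..d}. i mod m = j} \<le> card {0..d div m}"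
    by (intro card_inj_on_le) auto
  then show ?thesis by simp
qed

lemma none_true_eq:
  assumes "x \<in> cube d" "B \<subseteq> {1..d}"
  shows "(\<Prod>i\<in>B. (1 + x i) / 2) = (if \<exists>i\<in>B. x i = -1 then 0 else 1)"
proof -
  have "finite B" using assms finite_subset by auto
  have "x i = 1" if "i \<in> B" "x i \<noteq> - 1" for i
    using assms that unfolding cube_def by (auto simp: PiE_iff)
  then show ?thesis
    using \<open>finite B\<close> by (force intro!: prod.neutral)
qed

text \<open>The number of blocks with a true variable is at most \<open>m\<close> and at most
  \<open>num_true d x\<close>, hence the \<open>min\<close> in the hypothesis: it holds for every
  input if \<open>K = m\<close>, and for inputs with at most \<open>K\<close> true variables in
  general.\<close>

lemma OR_block_approximation:
  fixes d m K r :: nat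
  assumes "m \<ge> 1" "K \<ge> 1"
  obtains p where
    "\<And>x. x \<in> cube d \<Longrightarrow> min m (num_true d x) \<le> K \<Longrightarrow>
       \<bar>ml_eval d p x - OR_fun d x\<bar> \<le> 2 / (1 + (real r)\<^sup>2 / K)"
    "ml_weight d p \<le> 1 + 2 * (5 + 4 * real m / K) ^ r"
    "ml_degree d p \<le> r * (d div m + 1)"
proof -
  define B where "B j = {i \<in> {1..d}. i mod m = j}" for j
  define A where "A j x = (\<Prod>i\<in>B j. (1 + x i) / 2)" for j and x :: "nat \<Rightarrow> real"
  \<comment> \<open>If \<open>t\<close> blocks contain a true variable, the sum is
    \<open>m - t\<close> and \<open>y x = 1 + (1 - t) / K\<close>: outside [-1, 1] for
    \<open>t = 0\<close>, and in [1/K, 1] for \<open>t\<close> from 1 to \<open>K\<close>.\<close>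
  define y where "y x = (1 + (1 - real m) / K) + 1 / K * (\<Sum>j<m. A j x)" for x
  define s0 where "s0 = cheb r (1 + 1 / K)"
  define W where "W = \<bar>1 + (1 - real m) / K\<bar> + \<bar>1 / real K\<bar> * (real (card {..<m}) * 1)"
  have Bsub: "B j \<subseteq> {1..d}" for j by (auto simp: B_def)
  have "ml_representable d (A j) 1 (d div m + 1)" for j
    using ml_representable_cong[OF ml_representable_none_true[OF Bsub[of j]], of "A j" 1]
      card_residue_class_le[OF assms(1), of d j] by (simp add: A_def B_def)
  then have "ml_representable d y W (max 0 (d div m + 1))"
    unfolding y_def[abs_def] W_def
    by (intro ml_representable_add ml_representable_const ml_representable_cmult
        ml_representable_sum)
  then have rep_y: "ml_representable d y W (d div m + 1)" by simp
  have W: "0 \<le> W" "2 * W + 1 \<le> 5 + 4 * real m / K"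
  proof -
    show "0 \<le> W" by (simp add: W_def)
    have "\<bar>1 + (1 - real m) / K\<bar> \<le> 1 + (real m - 1) / K"
      using assms abs_triangle_ineq[of 1 "(1 - real m) / K"] by simp
    then have "W \<le> 1 + (real m - 1) / K + real m / K"
      unfolding W_def by simp
    also have "\<dots> \<le> 2 + 2 * real m / K"
      by (simp add: diff_divide_distrib order_trans[of _ 0])
    finally show "2 * W + 1 \<le> 5 + 4 * real m / K" by simp
  qed
  have s0: "s0 \<ge> 1 + (real r)\<^sup>2 / K"
    using cheb_growth[of "1 / real K" r] by (simp add: s0_def)
  then have s01: "s0 \<ge> 1" by (smt (verit) divide_nonneg_nonneg of_nat_0_le_iff zero_le_power2)
  \<comment> \<open>The normalisation by \<open>s0\<close> makes the value exactly 1 when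
    \<open>t = 0\<close>, and keeps it within \<open>2 / s0\<close> of -1 when \<open>y x\<close>
    lies in [-1, 1].\<close>
  have "ml_representable d (\<lambda>x. - 1 + 2 / s0 * cheb r (y x))
      (\<bar>- 1\<bar> + \<bar>2 / s0\<bar> * (2 * W + 1) ^ r) (max 0 (r * (d div m + 1)))"
    by (intro ml_representable_add ml_representable_const ml_representable_cmult
        ml_representable_cheb rep_y W)
  then obtain p where p: "\<And>x. x \<in> cube d \<Longrightarrow> ml_eval d p x = - 1 + 2 / s0 * cheb r (y x)"
    "ml_weight d p \<le> \<bar>- 1\<bar> + \<bar>2 / s0\<bar> * (2 * W + 1) ^ r"
    "ml_degree d p \<le> r * (d div m + 1)"
    unfolding ml_representable_def by auto
  show thesis
  proof (rule that)
    show "ml_degree d p \<le> r * (d div m + 1)" by fact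
    have "\<bar>2 / s0\<bar> * (2 * W + 1) ^ r \<le> 2 * (5 + 4 * real m / K) ^ r"
      using s01 W by (intro mult_mono power_mono) (auto simp: field_simps)
    with p(2) show "ml_weight d p \<le> 1 + 2 * (5 + 4 * real m / K) ^ r" by simp
    fix x assume x: "x \<in> cube d" and K: "min m (num_true d x) \<le> K"
    define N where "N = {i \<in> {1..d}. x i = -1}"
    define t where "t = card ((\<lambda>i. i mod m) ` N)"
    have finN: "finite N" by (simp add: N_def)
    have sub: "(\<lambda>i. i mod m) ` N \<subseteq> {..<m}" using assms by auto
    have "A j x = 1 - (if j \<in> (\<lambda>i. i mod m) ` N then 1 else 0)" for j
      unfolding A_def none_true_eq[OF x Bsub] by (auto simp: B_def N_def)
    then have "(\<Sum>j<m. A j x) = real m - (\<Sum>j<m. if j \<in> (\<lambda>i. i mod m) ` N then 1 else 0)"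
      by (simp add: sum_subtractf)
    also have "(\<Sum>j<m. if j \<in> (\<lambda>i. i mod m) ` N then 1 else 0) = real t"
      unfolding t_def using sub by (subst sum.inter_restrict[symmetric]) (auto simp: Int_absorb1)
    finally have yx: "y x = 1 + 1 / K - real t / K"
      by (simp add: y_def diff_divide_distrib)
    have "t \<le> card N" unfolding t_def by (rule card_image_le[OF finN])
    moreover have "t \<le> m" using card_mono[OF _ sub] by (simp add: t_def)
    ultimately have tK: "t \<le> K" using K by (simp add: num_true_def N_def)
    have pos: "0 < 1 + (real r)\<^sup>2 / K" by (simp add: add_pos_nonneg)
    show "\<bar>ml_eval d p x - OR_fun d x\<bar> \<le> 2 / (1 + (real r)\<^sup>2 / K)"
    proof (cases "N = {}")
      case True
      then have "y x = 1 + 1 / K" "OR_fun d x = 1"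
        by (auto simp: yx t_def OR_fun_def N_def)
      then show ?thesis using p(1)[OF x] s01 pos by (simp add: s0_def)
    next
      case False
      then have "OR_fun d x = - 1" by (auto simp: OR_fun_def N_def)
      have "t \<ge> 1" using False finN by (simp add: t_def Suc_le_eq card_gt_0_iff)
      then have "1 / real K \<le> real t / K" "real t / K \<le> 1" "0 \<le> 1 / real K"
        using tK assms by (auto simp: divide_right_mono)
      then have "\<bar>y x\<bar> \<le> 1"
        unfolding yx by linarith
      then have "\<bar>cheb r (y x)\<bar> \<le> 1" by (rule abs_cheb_le_1)
      then have "\<bar>ml_eval d p x - OR_fun d x\<bar> \<le> 2 / s0"
        using p(1)[OF x] \<open>OR_fun d x = - 1\<close> s01
        by (simp add: abs_mult divide_le_cancel)
      also have "\<dots> \<le> 2 / (1 + (real r)\<^sup>2 / K)"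
        using s0 pos by (intro divide_left_mono) auto
      finally show ?thesis .
    qed
  qed
qed

lemma OR_approximation:
  fixes d m K :: nat
  assumes "1 \<le> m" "m \<le> d" "1 \<le> K"
  obtains p where
    "\<And>x. x \<in> cube d \<Longrightarrow> min m (num_true d x) \<le> K \<Longrightarrow>
       \<bar>ml_eval d p x - OR_fun d x\<bar> \<le> 1 / 400"
    "ml_weight d p \<le> 3 * (5 + 4 * real m / K) powr (31 * sqrt K)"
    "real (ml_degree d p) \<le> 62 * sqrt K * d / m"
proof -
  \<comment> \<open>This gives \<open>r\<^sup>2 / K\<close> at least 900, so the error is at most
    2/901. Rounding up costs at most 1, which is at most \<open>sqrt K\<close>.\<close>
  define r where "r = nat \<lceil>30 * sqrt K\<rceil>"
  have s1: "sqrt K \<ge> 1" using assms by simp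
  have r: "30 * sqrt K \<le> r" "r \<le> 31 * sqrt K"
    using s1 unfolding r_def by linarith+
  obtain p where p: "\<And>x. x \<in> cube d \<Longrightarrow> min m (num_true d x) \<le> K \<Longrightarrow>
       \<bar>ml_eval d p x - OR_fun d x\<bar> \<le> 2 / (1 + (real r)\<^sup>2 / K)"
    "ml_weight d p \<le> 1 + 2 * (5 + 4 * real m / K) ^ r"
    "ml_degree d p \<le> r * (d div m + 1)"
    using OR_block_approximation[OF assms(1,3)] by blast
  show thesis
  proof (rule that)
    have "(30 * sqrt K)\<^sup>2 \<le> (real r)\<^sup>2" using r(1) by (intro power_mono) auto
    then have "900 \<le> (real r)\<^sup>2 / K" using assms by (simp add: field_simps)
    then have "2 / (1 + (real r)\<^sup>2 / K) \<le> 1 / 400" by (simp add: field_simps)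
    then show "\<bar>ml_eval d p x - OR_fun d x\<bar> \<le> 1 / 400"
      if "x \<in> cube d" "min m (num_true d x) \<le> K" for x
      using p(1)[OF that] by linarith
    let ?b = "5 + 4 * real m / K"
    have b: "?b \<ge> 1" by (simp add: add_increasing2)
    then have "?b ^ r = ?b powr r" by (subst powr_realpow) linarith+
    also have "\<dots> \<le> ?b powr (31 * sqrt K)" using b r by (intro powr_mono)
    finally have "?b ^ r \<le> ?b powr (31 * sqrt K)" .
    moreover have "1 \<le> ?b ^ r" using b by (rule one_le_power)
    ultimately show "ml_weight d p \<le> 3 * ?b powr (31 * sqrt K)" using p(2) by linarith
    have "real (d div m + 1) \<le> real d / m + 1"
      using of_nat_div_le_of_nat[of d m, where 'a = real] by simp
    \<comment> \<open>Here \<open>m \<le> d\<close> absorbs the summand 1; the constant 62 is 2 *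
      31.\<close>
    also have "\<dots> \<le> 2 * (real d / m)" using assms by (simp add: field_simps)
    finally have "real (d div m + 1) \<le> 2 * (real d / m)" .
    then have "real r * real (d div m + 1) \<le> (31 * sqrt K) * (2 * (real d / m))"
      using r by (intro mult_mono) auto
    then show "real (ml_degree d p) \<le> 62 * sqrt K * d / m"
      using of_nat_mono[OF p(3), where 'a = real] by (simp add: algebra_simps)
  qed
qed

section \<open>Small \<open>k\<close>: the block number is a small power of \<open>d\<close>\<close>

text \<open>With \<open>m\<close> close to \<open>d\<close> to the power
  \<open>1 / (10000 * sqrt k)\<close>, the exponent \<open>31 * sqrt k\<close> turns
  \<open>m\<close> into a factor of at most \<open>2 powr (0.0031 * L)\<close> in the weight. In the
  degree, one square root of \<open>m\<close> pays for \<open>62 * sqrt k\<close> and rounding, the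
  other is the gain.\<close>

lemma OR_approximation_few_true:
  fixes d k :: nat and L :: real
  assumes "d \<ge> 2" "k \<ge> 1" and L: "L = log 2 d" "L \<ge> 124" "3 * 2 powr (0.0062 * L) \<le> 2 powr (0.01 * L)"
    and small: "40000 * sqrt k * log 2 L \<le> L"
  obtains p where
    "\<And>x. x \<in> cube d \<Longrightarrow> num_true d x \<le> k \<Longrightarrow> \<bar>ml_eval d p x - OR_fun d x\<bar> \<le> 1 / 400"
    "ml_weight d p \<le> real d powr 0.01"
    "real (ml_degree d p) \<le> d powr (1 - 1 / (80000 * sqrt k))"
    "real (ml_degree d p) \<le> d / L powr 0.995"
proof -
  define s where "s = sqrt k"
  define M where "M = 2 powr (L / (10000 * s))"
  define m where "m = nat \<lfloor>M\<rfloor>"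
  have s1: "s \<ge> 1" using assms by (simp add: s_def)
  have dL: "real d = 2 powr L" using assms by simp
  have logL: "log 2 L \<ge> 1" using L(2) by (subst le_log_iff) auto
  have sL: "40000 * s \<le> L"
    using small mult_left_mono[OF logL, of "40000 * s"] s1 unfolding s_def by linarith
  \<comment> \<open>The smallness of \<open>k\<close> makes the square root of \<open>M\<close> at
    least \<open>L\<^sup>2\<close>, enough for both degree bounds.\<close>
  have "2 * log 2 L \<le> L / (20000 * s)"
    using small s1 by (simp add: field_simps s_def)
  then have "2 powr (2 * log 2 L) \<le> 2 powr (L / (20000 * s))" by (intro powr_mono) auto
  moreover have "2 powr (2 * log 2 L) = L\<^sup>2"
    using L(2) powr_powr[of 2 "log 2 L" 2] by (simp add: mult.commute powr_numeral)
  ultimately have L2: "L\<^sup>2 \<le> 2 powr (L / (20000 * s))" by simp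
  have M_sq: "M = 2 powr (L / (20000 * s)) * 2 powr (L / (20000 * s))"
    by (simp add: M_def flip: powr_add)
  have M1: "1 \<le> M" using L(2) s1 by (simp add: M_def ge_one_powr_ge_zero)
  have mM: "1 \<le> m" "real m \<le> M" "M \<le> real m + 1"
    using M1 unfolding m_def by linarith+
  have "L / (10000 * s) \<le> L" using L(2) s1 by (simp add: field_simps)
  then have "M \<le> d" unfolding dL M_def by (intro powr_mono) auto
  then have "m \<le> d" using mM by linarith
  obtain p where p: "\<And>x. x \<in> cube d \<Longrightarrow> min m (num_true d x) \<le> k \<Longrightarrow>
       \<bar>ml_eval d p x - OR_fun d x\<bar> \<le> 1 / 400"
    "ml_weight d p \<le> 3 * (5 + 4 * real m / k) powr (31 * sqrt k)"
    "real (ml_degree d p) \<le> 62 * sqrt k * d / m"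
    using OR_approximation[OF mM(1) \<open>m \<le> d\<close> assms(2)] by blast
  have deg: "real (ml_degree d p) \<le> d / 2 powr (L / (20000 * s))"
  proof -
    let ?q = "2 powr (L / (20000 * s)) :: real"
    have "124 * s \<le> L * L" using sL L(2) s1 by (intro mult_mono) auto
    then have "124 * s \<le> ?q" using L2 by (simp add: power2_eq_square)
    then have "124 * s * ?q \<le> ?q * ?q" by (intro mult_right_mono) auto
    also have "\<dots> \<le> 2 * real m" using mM M_sq by simp
    finally have "62 * s / m \<le> 1 / ?q" using mM(1) by (simp add: field_simps)
    then have "62 * s / m * d \<le> 1 / ?q * d" by (intro mult_right_mono) auto
    with p(3) show ?thesis by (simp add: s_def)
  qed
  show thesis
  proof (rule that)
    show "\<bar>ml_eval d p x - OR_fun d x\<bar> \<le> 1 / 400"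
      if "x \<in> cube d" "num_true d x \<le> k" for x
      using that p(1) by simp
    have "real m / k \<le> real m" using assms(2) divide_left_mono[of 1 "real k" "real m"] by simp
    \<comment> \<open>A power of two is convenient: 16 to the power \<open>31 * s\<close> is
      \<open>2 powr (124 * s)\<close>, and \<open>40000 * s \<le> L\<close> makes this at most
      \<open>2 powr (0.0031 * L)\<close>.\<close>
    then have "5 + 4 * real m / k \<le> 16 * M" using mM M1 by simp
    then have "(5 + 4 * real m / k) powr (31 * s) \<le> (16 * M) powr (31 * s)"
      using s1 by (intro powr_mono2) auto
    also have "16 * M = 2 powr (4 + L / (10000 * s))"
      by (simp add: M_def powr_add)
    also have "\<dots> powr (31 * s) = 2 powr (124 * s + 0.0031 * L)"
      unfolding powr_powr using s1 by (intro arg_cong[of _ _ "(powr) 2"]) (simp add: distrib_right)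
    also have "\<dots> \<le> 2 powr (0.0062 * L)"
      using sL by (intro powr_mono) auto
    finally have "ml_weight d p \<le> 3 * 2 powr (0.0062 * L)"
      using p(2) by (simp add: s_def)
    also have "\<dots> \<le> real d powr 0.01"
      using L(3) unfolding dL powr_powr by (simp add: mult.commute)
    finally show "ml_weight d p \<le> real d powr 0.01" .
    have "d / 2 powr (L / (20000 * s)) = 2 powr (L - L / (20000 * s))"
      by (simp add: dL powr_diff)
    also have "\<dots> \<le> 2 powr (L * (1 - 1 / (80000 * s)))"
      using L(2) s1 by (intro powr_mono) (auto simp: field_simps)
    also have "\<dots> = d powr (1 - 1 / (80000 * s))"
      by (simp add: dL powr_powr)
    finally show "real (ml_degree d p) \<le> d powr (1 - 1 / (80000 * sqrt k))"
      using deg by (simp add: s_def)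
    have "L powr 0.995 \<le> L powr 2" using L(2) by (intro powr_mono) auto
    then have "L powr 0.995 \<le> 2 powr (L / (20000 * s))"
      using L2 L(2) by (simp add: powr_numeral)
    then have "d / 2 powr (L / (20000 * s)) \<le> d / L powr 0.995"
      using L(2) by (intro divide_left_mono) auto
    with deg show "real (ml_degree d p) \<le> d / L powr 0.995" by linarith
  qed
qed

section \<open>Large \<open>k\<close>: one polynomial for all inputs\<close>

text \<open>With \<open>K = m\<close> the weight base is at most 9, so \<open>sqrt m\<close> may
  grow linearly in \<open>L\<close>. The degree is then of order \<open>d / L\<close>, and the slack
  between \<open>L\<close> and \<open>L powr 0.995\<close> absorbs the constants.\<close>

lemma OR_approximation_all:
  fixes d :: nat and L :: real
  assumes "d \<ge> 2" and L: "L = log 2 d" "L \<ge> 40000" "3 * 2 powr (0.0062 * L) \<le> 2 powr (0.01 * L)"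
    and large: "2480000 * L powr 0.995 \<le> L" "L\<^sup>2 \<le> d"
  obtains p where
    "\<And>x. x \<in> cube d \<Longrightarrow> \<bar>ml_eval d p x - OR_fun d x\<bar> \<le> 1 / 400"
    "ml_weight d p \<le> real d powr 0.01"
    "real (ml_degree d p) \<le> d / L powr 0.995"
proof -
  \<comment> \<open>As \<open>16 powr (31 * G) = 2 powr (124 * G)\<close>, the divisor 20000 gives
    the exponent \<open>0.0062 * L\<close>; the degree then needs 2480000 = 124 * 20000.\<close>
  define G where "G = L / 20000"
  define m where "m = nat \<lfloor>G\<^sup>2\<rfloor>"
  have dL: "real d = 2 powr L" using assms by simp
  have G: "G \<ge> 2" using L(2) by (simp add: G_def)
  have G4: "G\<^sup>2 \<ge> 4" using power_mono[OF G, of 2] by simp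
  have m: "1 \<le> m" "real m \<le> G\<^sup>2" "G\<^sup>2 \<le> 4 * real m"
    using G4 unfolding m_def by linarith+
  have "G\<^sup>2 \<le> L\<^sup>2" using L(2) by (intro power_mono) (auto simp: G_def)
  then have "m \<le> d" using m large(2) by linarith
  have sm: "sqrt m \<le> G" "G \<le> 2 * sqrt m"
    using real_sqrt_le_mono[OF m(2)] real_sqrt_le_mono[OF m(3)] G by (simp_all add: real_sqrt_mult)
  obtain p where p: "\<And>x. x \<in> cube d \<Longrightarrow> min m (num_true d x) \<le> m \<Longrightarrow>
       \<bar>ml_eval d p x - OR_fun d x\<bar> \<le> 1 / 400"
    "ml_weight d p \<le> 3 * (5 + 4 * real m / m) powr (31 * sqrt m)"
    "real (ml_degree d p) \<le> 62 * sqrt m * d / m"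
    using OR_approximation[OF m(1) \<open>m \<le> d\<close> m(1)] by blast
  show thesis
  proof (rule that)
    show "\<bar>ml_eval d p x - OR_fun d x\<bar> \<le> 1 / 400" if "x \<in> cube d" for x
      using p(1)[OF that] by simp
    have "(5 + 4 * real m / m) powr (31 * sqrt m) \<le> 16 powr (31 * sqrt m)"
      using m(1) by (intro powr_mono2) auto
    also have "\<dots> = 2 powr (124 * sqrt m)"
      using powr_powr[of 2 4 "31 * sqrt m"] by simp
    also have "\<dots> \<le> 2 powr (0.0062 * L)"
      using sm(1) by (intro powr_mono) (auto simp: G_def)
    finally have "ml_weight d p \<le> 3 * 2 powr (0.0062 * L)" using p(2) by linarith
    also have "\<dots> \<le> real d powr 0.01"
      using L(3) unfolding dL powr_powr by (simp add: mult.commute)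
    finally show "ml_weight d p \<le> real d powr 0.01" .
    have pos: "0 < sqrt m" "0 < L powr 0.995" using m(1) L(2) by auto
    have "124 * L powr 0.995 \<le> G" using large(1) by (simp add: G_def)
    then have "62 * L powr 0.995 \<le> sqrt m" using sm(2) by linarith
    then have "62 / sqrt m \<le> 1 / L powr 0.995" using pos by (simp add: field_simps)
    then have "62 / sqrt m * d \<le> 1 / L powr 0.995 * d" by (intro mult_right_mono) auto
    moreover have "62 * sqrt m * d / m = 62 / sqrt m * d"
      using pos(1) by (simp add: field_simps flip: real_sqrt_mult)
    ultimately show "real (ml_degree d p) \<le> d / L powr 0.995" using p(3) by simp
  qed
qed

section \<open>Combining the two ranges of \<open>k\<close>\<close>

theorem theorem1p3:
  "\<exists>C::real. C > 0 \<and> (\<exists>d\<^sub>0::nat. \<forall>d\<ge>d\<^sub>0. \<forall>k\<in>{1..d}. \<exists>p :: nat set \<Rightarrow> real.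
     (\<forall>x\<in>cube d. num_true d x \<le> k \<longrightarrow> \<bar>ml_eval d p x - OR_fun d x\<bar> \<le> 1 / 400) \<and>
     ml_weight d p \<le> real d powr 0.01 \<and>
     real (ml_degree d p) \<le>
       min (real d powr (1 - 1 / (C * sqrt (real k))))
           (real d / (log 2 (real d)) powr 0.995))"
proof -
  have "\<forall>\<^sub>F d in sequentially. 2 \<le> d"
    by (rule eventually_ge_at_top)
  moreover have "\<forall>\<^sub>F d in sequentially. 40000 \<le> log 2 (real d)"
    by real_asymp
  moreover have "\<forall>\<^sub>F d in sequentially. 2480000 * log 2 (real d) powr 0.995 \<le> log 2 (real d)"
    by real_asymp
  moreover have "\<forall>\<^sub>F d in sequentially. (log 2 (real d))\<^sup>2 \<le> real d"
    by real_asymp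
  moreover have "\<forall>\<^sub>F d in sequentially.
      3 * 2 powr (0.0062 * log 2 (real d)) \<le> 2 powr (0.01 * log 2 (real d))"
    by real_asymp
  ultimately have "\<forall>\<^sub>F d in sequentially. 2 \<le> d \<and> 40000 \<le> log 2 (real d) \<and>
      2480000 * log 2 (real d) powr 0.995 \<le> log 2 (real d) \<and> (log 2 (real d))\<^sup>2 \<le> real d \<and>
      3 * 2 powr (0.0062 * log 2 (real d)) \<le> 2 powr (0.01 * log 2 (real d))"
    by eventually_elim simp
  then obtain d0 where d0: "\<And>d. d0 \<le> d \<Longrightarrow> 2 \<le> d \<and> 40000 \<le> log 2 (real d) \<and>
      2480000 * log 2 (real d) powr 0.995 \<le> log 2 (real d) \<and> (log 2 (real d))\<^sup>2 \<le> real d \<and>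
      3 * 2 powr (0.0062 * log 2 (real d)) \<le> 2 powr (0.01 * log 2 (real d))"
    unfolding eventually_sequentially by metis
  show ?thesis
  \<comment> \<open>Small \<open>k\<close> would allow the constant 20000; large \<open>k\<close>
    needs at least 40000 / 0.995.\<close>
  proof (rule exI[of _ 80000], intro conjI exI[of _ d0] allI impI ballI)
    fix d k assume "d \<ge> d0" and k: "k \<in> {1..d}"
    define L where "L = log 2 (real d)"
    have d: "d \<ge> 2" "L \<ge> 40000" "2480000 * L powr 0.995 \<le> L" "L\<^sup>2 \<le> d"
      "3 * 2 powr (0.0062 * L) \<le> 2 powr (0.01 * L)"
      using d0[OF \<open>d \<ge> d0\<close>] unfolding L_def by blast+
    show "\<exists>p. (\<forall>x\<in>cube d. num_true d x \<le> k \<longrightarrow> \<bar>ml_eval d p x - OR_fun d x\<bar> \<le> 1 / 400) \<and>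
      ml_weight d p \<le> real d powr 0.01 \<and>
      real (ml_degree d p) \<le> min (real d powr (1 - 1 / (80000 * sqrt (real k))))
        (real d / (log 2 (real d)) powr 0.995)"
    proof (cases "40000 * sqrt k * log 2 L \<le> L")
      case True
      obtain p where
        "\<And>x. x \<in> cube d \<Longrightarrow> num_true d x \<le> k \<Longrightarrow> \<bar>ml_eval d p x - OR_fun d x\<bar> \<le> 1 / 400"
        "ml_weight d p \<le> real d powr 0.01"
        "real (ml_degree d p) \<le> d powr (1 - 1 / (80000 * sqrt k))"
        "real (ml_degree d p) \<le> d / L powr 0.995"
        by (rule OR_approximation_few_true[OF d(1) _ L_def _ d(5) True]) (use k d(2) in auto)
      then show ?thesis
        unfolding L_def by (intro exI[of _ p]) auto
    next
      case False
      obtain p where p: "\<And>x. x \<in> cube d \<Longrightarrow> \<bar>ml_eval d p x - OR_fun d x\<bar> \<le> 1 / 400"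
        "ml_weight d p \<le> real d powr 0.01" "real (ml_degree d p) \<le> d / L powr 0.995"
        using OR_approximation_all[OF d(1) L_def d(2,5,3,4)] by blast
      have s1: "sqrt k \<ge> 1" using k by simp
      have dL: "real d = 2 powr L" using d(1) by (simp add: L_def)
      have logL: "log 2 L \<ge> 0" using d(2) by simp
      \<comment> \<open>It remains to see that the second term of the minimum is the smaller one.
        Compared as exponents of 2, this needs \<open>L \<le> 79600 * (sqrt k * log 2 L)\<close>,
        where 79600 = 0.995 * 80000.\<close>
      have "L \<le> 40000 * (sqrt k * log 2 L)" "0 \<le> sqrt k * log 2 L"
        using False s1 logL by auto
      then have "L \<le> 79600 * (sqrt k * log 2 L)" by linarith
      then have "L / (80000 * sqrt k) \<le> 0.995 * log 2 L"
        using s1 by (simp add: field_simps)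
      then have "2 powr (L - 0.995 * log 2 L) \<le> 2 powr (L * (1 - 1 / (80000 * sqrt k)))"
        by (intro powr_mono) (auto simp: right_diff_distrib)
      also have "\<dots> = d powr (1 - 1 / (80000 * sqrt k))"
        by (simp add: dL powr_powr)
      also have "2 powr (L - 0.995 * log 2 L) = d / L powr 0.995"
        using d(2) powr_powr[of 2 "log 2 L" "0.995"] by (simp add: dL powr_diff mult.commute)
      finally show ?thesis
        using p unfolding L_def by (intro exI[of _ p]) auto
    qed
  qed simp
qed

end
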